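(* The Nash equilibrium threshold value when reneging is allowed is greater than or equal to that when reneging is not allowed: if, for the same parameters $R_0,\lambda,\mu,q$, $x_e$ denotes the Nash equilibrium threshold value in the non-reneging case and $\hat x_e$ denotes a Nash equilibrium threshold value in the reneging case, then $\hat x_e\ge x_e$.
   Context: Parameters $\lambda,\mu>0$, $0<q<1$, $R_0>0$. Single-server first-come-first-served queue: Poisson arrivals of rate $\lambda$, i.i.d. exponential($\mu$) services. After each service a customer departs successfully with probability $q$ (reward $R_0$); otherwise the service fails and she immediately goes to the end of the queue. An arriving customer who sees $j-1$ customers in the system may join, taking position $j$ (position 1 is in service), or balk (payoff 0). Waiting costs 1 per unit time. Threshold strategy: for $x\ge 0$, with $n=\lfloor x\rfloor$ and $p=x-n$: $u^{(x)}(i)=1$ if $i\le n$, $u^{(x)}(n+1)=p$, $u^{(x)}(i)=0$ if $i\ge n+2$. Non-reneging case ($N$-case): a customer with threshold $x$ joins at position $i$ with probability $u^{(x)}(i)$ and then stays until success. For $1\le i\le j\le\lceil x\rceil+1$, $w^{(x)}_{i,j}$ is the expected remaining time in the system of a tagged customer in position $i$ with $j$ customers in the system, all others using threshold $x$; it is the unique solution of $$(\lambda+\mu)w_{i,j}=1+\lambda\left[u^{(x)}(j+1)w_{i,j+1}+(1-u^{(x)}(j+1))w_{i,j}\right]+\mu\, s_{i,j},$$ with $s_{1,j}=(1-q)w_{j,j}$ and $s_{i,j}=q\,w_{i-1,j-1}+(1-q)\,w_{i-1,j}$ for $i>1$ (terms with zero coefficient are omitted). For $m\ge1$ let $\alpha_m=w^{(m)}_{m,m}$,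 $\beta_m=w^{(m)}_{m+1,m+1}$, and, when $\beta_m<R_0<\alpha_{m+1}$, let $\chi_m\in(m,m+1)$ be the unique solution of $w^{(\chi_m)}_{m+1,m+1}=R_0$. The $N$-case equilibrium threshold is $x_e=0$ if $R_0<\alpha_1$, $x_e=m$ if $\alpha_m\le R_0\le\beta_m$ ($m\ge1$), $x_e=\chi_m$ if $\beta_m<R_0<\alpha_{m+1}$ ($m\ge 1$). Reneging case ($R$-case): in addition, a customer with threshold $x$ whose service fails, and who would be in position $i$ at the end of the queue, stays with probability $u^{(x)}(i)$ and otherwise leaves without reward. For others' threshold $x$ with $n=\lfloor x\rfloor$ and tagged customer's threshold $x_{tag}\in[n,n+1]$, $\hat z^{(x_{tag},x)}_{i,j}$ ($1\le i\le j\le n+1$) is the tagged customer's expected future payoff (reward minus waiting cost) when she is in position $i$ and $j$ customers are in the system; it is the unique solution of $$(\lambda+\mu)\hat z_{i,j}=-1+\lambda\left[u^{(x)}(j+1)\hat z_{i,j+1}+(1-u^{(x)}(j+1))\hat z_{i,j}\right]+\mu\,\hat s_{i,j},$$ with $\hat s_{1,j}=qR_0+(1-q)u^{(x_{tag})}(j)\hat z_{j,j}$ and $\hat s_{i,j}=\left[q+(1-q)(1-u^{(x)}(j))\right]\hat z_{i-1,j-1}+(1-q)u^{(x)}(j)\hat z_{i-1,j}$ for $i>1$. The $R$-case Nash equilibrium threshold $\hat x_e$ is: $\hat x_e=0$ if $R_0<\alpha_1$; if $R_0\ge\alpha_1$, either $\hat x_e=m$ for an integer $m\ge1$ with $\hat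 z^{(m+1,m)}_{m+1,m+1}\le0\le\hat z^{(m,m)}_{m,m}$ (best response to $m$ is $m$), or $\hat x_e\in(m,m+1)$ for an integer $m\ge1$ with $\hat z^{(m+1,\hat x_e)}_{m+1,m+1}=0$ (indifference at position $m+1$). *)

theory Defs
  imports Complex_Main
begin

definition threshold_strategy :: "real \<Rightarrow> nat \<Rightarrow> real" where
  "threshold_strategy x i =
     (let n = nat \<lfloor>x\<rfloor> in
      if i \<le> n then 1 else if i = n + 1 then x - real n else 0)"

definition triangle :: "nat \<Rightarrow> (nat \<times> nat) set" where
  "triangle N = {(i, j). 1 \<le> i \<and> i \<le> j \<and> j \<le> N}"

text \<open>
  First-step equations for the expected remaining time without reneging. For \<open>x \<ge> 0\<close> the largest
  admissible \<open>j\<close> satisfies \<open>threshold_strategy x (j + 1) = 0\<close>, so values of \<open>w\<close> outside the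
  index range occur only with coefficient zero.
\<close>

definition N_service_term :: "real \<Rightarrow> (nat \<Rightarrow> nat \<Rightarrow> real) \<Rightarrow> nat \<Rightarrow> nat \<Rightarrow> real" where
  "N_service_term q w i j =
     (if i = 1 then (1 - q) * w j j
      else q * w (i - 1) (j - 1) + (1 - q) * w (i - 1) j)"

definition N_equations ::
  "real \<Rightarrow> real \<Rightarrow> real \<Rightarrow> real \<Rightarrow> (nat \<Rightarrow> nat \<Rightarrow> real) \<Rightarrow> bool" where
  "N_equations lam mu q x w \<longleftrightarrow>
     (\<forall>(i, j) \<in> triangle (nat \<lceil>x\<rceil> + 1).
        (lam + mu) * w i j =
          1 + lam * (threshold_strategy x (j + 1) * w i (j + 1)
                     + (1 - threshold_strategy x (j + 1)) * w i j)
            + mu * N_service_term q w i j)"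

text \<open>
  The equations determine a solution only on the index range; it is normalised to zero elsewhere
  so that it is unique as a total function.
\<close>

definition N_time :: "real \<Rightarrow> real \<Rightarrow> real \<Rightarrow> real \<Rightarrow> nat \<Rightarrow> nat \<Rightarrow> real" where
  "N_time lam mu q x =
     (THE w. N_equations lam mu q x w
           \<and> (\<forall>i j. (i, j) \<notin> triangle (nat \<lceil>x\<rceil> + 1) \<longrightarrow> w i j = 0))"

definition N_alpha :: "real \<Rightarrow> real \<Rightarrow> real \<Rightarrow> nat \<Rightarrow> real" where
  "N_alpha lam mu q m = N_time lam mu q (real m) m m"

definition N_beta :: "real \<Rightarrow> real \<Rightarrow> real \<Rightarrow> nat \<Rightarrow> real" where
  "N_beta lam mu q m = N_time lam mu q (real m) (m + 1) (m + 1)"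

definition N_equilibrium :: "real \<Rightarrow> real \<Rightarrow> real \<Rightarrow> real \<Rightarrow> real \<Rightarrow> bool" where
  "N_equilibrium lam mu q R0 x \<longleftrightarrow>
     (R0 < N_alpha lam mu q 1 \<and> x = 0)
   \<or> (\<exists>m\<ge>1. N_alpha lam mu q m \<le> R0 \<and> R0 \<le> N_beta lam mu q m \<and> x = real m)
   \<or> (\<exists>m\<ge>1. N_beta lam mu q m < R0 \<and> R0 < N_alpha lam mu q (m + 1)
          \<and> real m < x \<and> x < real (m + 1)
          \<and> N_time lam mu q x (m + 1) (m + 1) = R0)"

text \<open>
  Payoff equations with reneging: \<open>y\<close> is the threshold of the tagged customer, \<open>x\<close> that of all
  the others, with \<open>\<lfloor>x\<rfloor> \<le> y \<le> \<lfloor>x\<rfloor> + 1\<close>.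
\<close>

definition R_service_term ::
  "real \<Rightarrow> real \<Rightarrow> real \<Rightarrow> real \<Rightarrow> (nat \<Rightarrow> nat \<Rightarrow> real) \<Rightarrow> nat \<Rightarrow> nat \<Rightarrow> real" where
  "R_service_term q R0 y x z i j =
     (if i = 1 then q * R0 + (1 - q) * threshold_strategy y j * z j j
      else (q + (1 - q) * (1 - threshold_strategy x j)) * z (i - 1) (j - 1)
           + (1 - q) * threshold_strategy x j * z (i - 1) j)"

definition R_equations ::
  "real \<Rightarrow> real \<Rightarrow> real \<Rightarrow> real \<Rightarrow> real \<Rightarrow> real \<Rightarrow> (nat \<Rightarrow> nat \<Rightarrow> real) \<Rightarrow> bool" where
  "R_equations lam mu q R0 y x z \<longleftrightarrow>
     (\<forall>(i, j) \<in> triangle (nat \<lfloor>x\<rfloor> + 1).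
        (lam + mu) * z i j =
          - 1 + lam * (threshold_strategy x (j + 1) * z i (j + 1)
                       + (1 - threshold_strategy x (j + 1)) * z i j)
              + mu * R_service_term q R0 y x z i j)"

definition R_payoff ::
  "real \<Rightarrow> real \<Rightarrow> real \<Rightarrow> real \<Rightarrow> real \<Rightarrow> real \<Rightarrow> nat \<Rightarrow> nat \<Rightarrow> real" where
  "R_payoff lam mu q R0 y x =
     (THE z. R_equations lam mu q R0 y x z
           \<and> (\<forall>i j. (i, j) \<notin> triangle (nat \<lfloor>x\<rfloor> + 1) \<longrightarrow> z i j = 0))"

text \<open>
  Nobody joins behind a lone customer when the others use threshold 1, so reneging plays no part
  in \<open>N_alpha\<close> at 1, which also delimits the equilibrium threshold zero here.
\<close>

definition R_equilibrium :: "real \<Rightarrow> real \<Rightarrow> real \<Rightarrow> real \<Rightarrow> real \<Rightarrow> bool" where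
  "R_equilibrium lam mu q R0 x \<longleftrightarrow>
     (R0 < N_alpha lam mu q 1 \<and> x = 0)
   \<or> (N_alpha lam mu q 1 \<le> R0
      \<and> ((\<exists>m\<ge>1. x = real m
             \<and> R_payoff lam mu q R0 (real (m + 1)) (real m) (m + 1) (m + 1) \<le> 0
             \<and> 0 \<le> R_payoff lam mu q R0 (real m) (real m) m m)
         \<or> (\<exists>m\<ge>1. real m < x \<and> x < real (m + 1)
             \<and> R_payoff lam mu q R0 (real (m + 1)) x (m + 1) (m + 1) = 0)))"

end

theory Submission
  imports Defs
begin

text \<open>
  A tagged customer who never reneges earns \<open>R0\<close> in the end, so with threshold \<open>n + 1\<close> her payoff is
  \<open>R0\<close> minus her expected time in the system, where only the others renege. The theorem compares
  such times with those of the system without reneging: if the others use \<open>x\<close>, with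
  \<open>n \<le> x < n + 1\<close>, and may renege, then she leaves sooner than if they use some \<open>x'\<close> with
  \<open>x < x' \<le> n + 1\<close> and always stay (\<open>R_time_less_N_time\<close>). At an equilibrium \<open>x \<ge> 1\<close> with
  reneging her payoff at position \<open>n + 1\<close> is not positive, so her time is at least \<open>R0\<close>, and therefore every
  \<open>x'\<close> in that range makes the time without reneging exceed \<open>R0\<close>. For \<open>x' = n + 1\<close>
  this says \<open>R0 < N_alpha (n + 1)\<close>, and since \<open>N_alpha\<close> is increasing, the equilibrium without
  reneging has integer part at most \<open>n\<close>; if it is \<open>n\<close>, then an equilibrium \<open>x'\<close> beyond \<open>x\<close> is fractional and would have time
  exactly \<open>R0\<close>, which is excluded as well. If \<open>x = 0\<close>, then \<open>R0\<close> is below every \<open>N_alpha m\<close>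
  and both equilibria are zero.

  The comparison of times is a maximum principle for the first-step equations
  (\<open>maximum_principle\<close>). Inserting the time \<open>w\<close> of the more crowded system into the equations of
  the other one leaves a defect that is a combination of increments \<open>w i (j + 1) - w i j\<close> with
  nonnegative coefficients (\<open>step_defect\<close>). What remains is that \<open>w\<close> increases with the number
  \<open>j\<close> of customers. This does not reproduce itself under the equations: a failing customer goes to
  the last position, so monotonicity in the position \<open>i\<close> is needed too, and at the front of the
  queue that needs the inequality
  \<open>(1 - q) * w (j + 1) (j + 1) \<le> q * w 1 j + (1 - q) * w 1 (j + 1)\<close>. The three properties together
  are preserved by the iteration that converges to \<open>w\<close> (\<open>congestion_mono_step\<close>). The third is
  strict at the fixed point, and this makes the comparison of times strict.
\<close>

section \<open>First-step operators\<close>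

lemma triangle_iff [simp]: "(i, j) \<in> triangle N \<longleftrightarrow> 1 \<le> i \<and> i \<le> j \<and> j \<le> N"
  by (simp add: triangle_def)

lemma finite_triangle: "finite (triangle N)"
  by (rule finite_subset[of _ "{..N} \<times> {..N}"]) (auto simp: triangle_def)

locale feedback_queue =
  fixes lam mu q :: real
  assumes lam_pos: "0 < lam" and mu_pos: "0 < mu" and q_pos: "0 < q" and q_less_1: "q < 1"
begin

definition arrival :: "(nat \<Rightarrow> real) \<Rightarrow> (nat \<Rightarrow> nat \<Rightarrow> real) \<Rightarrow> nat \<Rightarrow> nat \<Rightarrow> real" where
  "arrival a w i j = a (j + 1) * w i (j + 1) + (1 - a (j + 1)) * w i j"

definition service :: "(nat \<Rightarrow> real) \<Rightarrow> (nat \<Rightarrow> nat \<Rightarrow> real) \<Rightarrow> nat \<Rightarrow> nat \<Rightarrow> real" where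
  "service b w i j =
     (if i = 1 then (1 - q) * w j j
      else (q + (1 - q) * (1 - b j)) * w (i - 1) (j - 1) + (1 - q) * b j * w (i - 1) j)"

text \<open>
  Joining probabilities \<open>a\<close> and staying probabilities \<open>b\<close> are independent parameters, so that the
  system without reneging is the case \<open>b = (\<lambda>_. 1)\<close> and the one with reneging is \<open>b = a\<close>.
\<close>

definition step ::
  "(nat \<Rightarrow> real) \<Rightarrow> (nat \<Rightarrow> real) \<Rightarrow> (nat \<Rightarrow> nat \<Rightarrow> real) \<Rightarrow> nat \<Rightarrow> nat \<Rightarrow> real" where
  "step a b w i j = lam * arrival a w i j + mu * service b w i j"

definition sojourn ::
  "nat \<Rightarrow> (nat \<Rightarrow> real) \<Rightarrow> (nat \<Rightarrow> real) \<Rightarrow> (nat \<Rightarrow> nat \<Rightarrow> real) \<Rightarrow> bool" where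
  "sojourn N a b w \<longleftrightarrow> (\<forall>(i, j) \<in> triangle N. (lam + mu) * w i j = 1 + step a b w i j)"

text \<open>
  Nobody joins when \<open>N\<close> customers are present: this closes the equations on \<open>triangle N\<close>.
\<close>

definition admissible :: "nat \<Rightarrow> (nat \<Rightarrow> real) \<Rightarrow> (nat \<Rightarrow> real) \<Rightarrow> bool" where
  "admissible N a b \<longleftrightarrow>
     (\<forall>j. 0 \<le> a j \<and> a j \<le> 1 \<and> 0 \<le> b j \<and> b j \<le> 1) \<and> a (N + 1) = 0"

lemma sojournD:
  "sojourn N a b w \<Longrightarrow> 1 \<le> i \<Longrightarrow> i \<le> j \<Longrightarrow> j \<le> N \<Longrightarrow> (lam + mu) * w i j = 1 + step a b w i j"
  by (auto simp: sojourn_def)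

lemma step_diff: "step a b (\<lambda>i j. v i j - w i j) i j = step a b v i j - step a b w i j"
  by (simp add: step_def arrival_def service_def algebra_simps)

lemma step_scale: "step a b (\<lambda>i j. c * w i j) i j = c * step a b w i j"
  by (simp add: step_def arrival_def service_def algebra_simps)

lemma step_mono:
  assumes ad: "admissible N a b"
    and le: "\<And>i j. 1 \<le> i \<Longrightarrow> i \<le> j \<Longrightarrow> j \<le> N \<Longrightarrow> v i j \<le> w i j"
    and ij: "1 \<le> i" "i \<le> j" "j \<le> N"
  shows "step a b v i j \<le> step a b w i j"
proof -
  have rng: "0 \<le> a k" "a k \<le> 1" "0 \<le> b k" "b k \<le> 1" for k
    using ad by (auto simp: admissible_def)
  have "a (j + 1) * v i (j + 1) \<le> a (j + 1) * w i (j + 1)"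
  proof (cases "j = N")
    case True
    then show ?thesis using ad by (simp add: admissible_def)
  next
    case False
    then show ?thesis using ij rng by (intro mult_left_mono le) auto
  qed
  moreover have "(1 - a (j + 1)) * v i j \<le> (1 - a (j + 1)) * w i j"
    using ij rng by (intro mult_left_mono le) auto
  ultimately have A: "arrival a v i j \<le> arrival a w i j"
    by (simp add: arrival_def)
  have S: "service b v i j \<le> service b w i j"
  proof (cases "i = 1")
    case True
    have "(1 - q) * v j j \<le> (1 - q) * w j j"
      using ij q_less_1 by (intro mult_left_mono le) auto
    then show ?thesis by (simp add: service_def True)
  next
    case False
    have "(q + (1 - q) * (1 - b j)) * v (i - 1) (j - 1) \<le> (q + (1 - q) * (1 - b j)) * w (i - 1) (j - 1)"
      using ij False q_less_1 q_pos rng by (intro mult_left_mono le) auto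
    moreover have "(1 - q) * b j * v (i - 1) j \<le> (1 - q) * b j * w (i - 1) j"
      using ij False q_less_1 rng by (intro mult_left_mono le) auto
    ultimately show ?thesis using False by (simp add: service_def)
  qed
  show ?thesis
    unfolding step_def using A S lam_pos mu_pos
    by (intro add_mono mult_left_mono) auto
qed

lemma step_cong:
  assumes "admissible N a b"
    and "\<And>i j. 1 \<le> i \<Longrightarrow> i \<le> j \<Longrightarrow> j \<le> N \<Longrightarrow> v i j = w i j"
    and "1 \<le> i" "i \<le> j" "j \<le> N"
  shows "step a b v i j = step a b w i j"
  using assms by (intro antisym step_mono[of N]) auto

section \<open>Comparison, uniqueness and existence\<close>

text \<open>
  The time of the most pessimistic tagged customer: her first result comes with the
  \<open>i\<close>th service, and each of her \<open>(1 - q) / q\<close> expected failures costs her at most \<open>N\<close> more. The same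
  function bounds the iteration from above and serves as weight in the maximum principle.
\<close>

definition barrier :: "nat \<Rightarrow> nat \<Rightarrow> nat \<Rightarrow> real" where
  "barrier N i j = (real i + (1 - q) * real N / q) / mu"

lemma barrier_pos: "1 \<le> i \<Longrightarrow> 0 < barrier N i j"
  unfolding barrier_def using mu_pos q_pos q_less_1
  by (intro divide_pos_pos add_pos_nonneg divide_nonneg_pos mult_nonneg_nonneg) auto

lemma barrier_position: "barrier N i j = barrier N i k"
  by (simp add: barrier_def)

lemma barrier_step:
  assumes "1 \<le> i" "i \<le> j" "j \<le> N"
  shows "1 + step a b (barrier N) i j \<le> (lam + mu) * barrier N i j"
proof -
  have A: "arrival a (barrier N) i j = barrier N i j"
    using barrier_position[of N i "j + 1" j] by (simp add: arrival_def algebra_simps)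
  have S: "1 + mu * service b (barrier N) i j \<le> mu * barrier N i j"
  proof (cases "i = 1")
    case True
    have "(1 - q) * real j \<le> (1 - q) * real N"
      using assms q_less_1 by (intro mult_left_mono) auto
    moreover have "mu * barrier N k l = real k + (1 - q) * real N / q" for k l
      using mu_pos by (simp add: barrier_def)
    moreover have "(1 - q) * ((1 - q) * real N / q) = (1 - q) * real N / q - (1 - q) * real N"
      using q_pos by (simp add: field_simps)
    moreover have "mu * service b (barrier N) i j = (1 - q) * (mu * barrier N j j)"
      by (simp add: service_def True)
    ultimately show ?thesis
      by (simp add: True distrib_left)
  next
    case False
    have "service b (barrier N) i j = barrier N (i - 1) j"
      using False barrier_position[of N "i - 1" "j - 1" j] by (simp add: service_def algebra_simps)
    moreover have "mu * barrier N k l = real k + (1 - q) * real N / q" for k l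
      using mu_pos by (simp add: barrier_def)
    ultimately show ?thesis
      using assms by (simp add: of_nat_diff)
  qed
  show ?thesis using A S by (simp add: step_def distrib_right)
qed

text \<open>
  Where \<open>d / barrier\<close> is maximal, with value \<open>k\<close>, the equation bounds \<open>d\<close> by the image of
  \<open>k * barrier\<close>. The constant 1 in \<open>barrier_step\<close> makes that image smaller than \<open>k * barrier\<close>
  unless \<open>k \<le> 0\<close>.
\<close>

lemma maximum_principle:
  assumes ad: "admissible N a b"
    and sub: "\<And>i j. 1 \<le> i \<Longrightarrow> i \<le> j \<Longrightarrow> j \<le> N \<Longrightarrow> (lam + mu) * d i j \<le> step a b d i j"
    and ij: "1 \<le> i" "i \<le> j" "j \<le> N"
  shows "d i j \<le> 0"
proof (rule ccontr)
  assume "\<not> d i j \<le> 0"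
  then have pos: "0 < d i j" by simp
  define ratio where "ratio = (\<lambda>(i, j). d i j / barrier N i j)"
  define k where "k = Max (ratio ` triangle N)"
  have fin: "finite (ratio ` triangle N)" by (simp add: finite_triangle)
  have "ratio (i, j) \<le> k"
    unfolding k_def using fin ij by (intro Max_ge) auto
  moreover have "0 < ratio (i, j)"
    using pos barrier_pos[OF ij(1)] by (simp add: ratio_def)
  ultimately have k_pos: "0 < k" by simp
  have "k \<in> ratio ` triangle N"
    unfolding k_def using fin ij by (intro Max_in) (auto simp: ex_in_conv[symmetric])
  then obtain i' j' where ij': "1 \<le> i'" "i' \<le> j'" "j' \<le> N" and k: "k = ratio (i', j')"
    by auto
  have eq: "d i' j' = k * barrier N i' j'"
    using barrier_pos[OF ij'(1), of N j'] by (simp add: k ratio_def)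
  have le: "d r s \<le> k * barrier N r s" if "1 \<le> r" "r \<le> s" "s \<le> N" for r s
  proof -
    have "ratio (r, s) \<le> k"
      unfolding k_def using fin that by (intro Max_ge) auto
    then show ?thesis
      using barrier_pos[OF that(1), of N s] by (simp add: ratio_def divide_le_eq)
  qed
  have "(lam + mu) * d i' j' \<le> step a b d i' j'" by (rule sub[OF ij'])
  also have "\<dots> \<le> k * step a b (barrier N) i' j'"
    using step_mono[OF ad le ij'] by (simp add: step_scale)
  also have "\<dots> \<le> k * ((lam + mu) * barrier N i' j' - 1)"
    using barrier_step[OF ij', of a b] k_pos by (intro mult_left_mono) auto
  finally show False using k_pos by (simp add: eq algebra_simps)
qed

lemma sojourn_unique:
  assumes ad: "admissible N a b" and v: "sojourn N a b v" and w: "sojourn N a b w"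
    and ij: "1 \<le> i" "i \<le> j" "j \<le> N"
  shows "v i j = w i j"
proof (rule antisym)
  have "v i j - w i j \<le> 0"
    by (rule maximum_principle[OF ad _ ij])
      (simp add: step_diff right_diff_distrib sojournD[OF v] sojournD[OF w])
  then show "v i j \<le> w i j" by simp
  have "w i j - v i j \<le> 0"
    by (rule maximum_principle[OF ad _ ij])
      (simp add: step_diff right_diff_distrib sojournD[OF v] sojournD[OF w])
  then show "w i j \<le> v i j" by simp
qed

fun iterate ::
  "(nat \<Rightarrow> real) \<Rightarrow> (nat \<Rightarrow> real) \<Rightarrow> nat \<Rightarrow> nat \<Rightarrow> nat \<Rightarrow> real" where
  "iterate a b 0 i j = 0"
| "iterate a b (Suc k) i j = (1 + step a b (iterate a b k) i j) / (lam + mu)"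

lemma iterate_Suc_mono:
  assumes ad: "admissible N a b" and ij: "1 \<le> i" "i \<le> j" "j \<le> N"
  shows "iterate a b k i j \<le> iterate a b (Suc k) i j"
  using ij
proof (induction k arbitrary: i j)
  case 0
  then show ?case
    using lam_pos mu_pos by (simp add: step_def arrival_def service_def)
next
  case (Suc k)
  have "step a b (iterate a b k) i j \<le> step a b (iterate a b (Suc k)) i j"
    by (rule step_mono[OF ad Suc.IH Suc.prems])
  then show ?case
    unfolding iterate.simps(2) using lam_pos mu_pos by (intro divide_right_mono) auto
qed

lemma iterate_le_barrier:
  assumes ad: "admissible N a b" and ij: "1 \<le> i" "i \<le> j" "j \<le> N"
  shows "iterate a b k i j \<le> barrier N i j"
  using ij
proof (induction k arbitrary: i j)
  case 0
  then show ?case using barrier_pos[of i N j] by simp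
next
  case (Suc k)
  have "1 + step a b (iterate a b k) i j \<le> 1 + step a b (barrier N) i j"
    using step_mono[OF ad Suc.IH Suc.prems] by simp
  also have "\<dots> \<le> (lam + mu) * barrier N i j"
    by (rule barrier_step[OF Suc.prems])
  finally show ?case
    using lam_pos mu_pos by (simp add: divide_le_eq mult.commute)
qed

text \<open>
  Existence is obtained by iteration from zero because inequalities that the iterates satisfy
  then pass to the solution.
\<close>

lemma iterate_converges:
  assumes ad: "admissible N a b"
  shows "\<exists>w. sojourn N a b w
    \<and> (\<forall>(i, j) \<in> triangle N. (\<lambda>k. iterate a b k i j) \<longlonglongrightarrow> w i j)
    \<and> (\<forall>i j. (i, j) \<notin> triangle N \<longrightarrow> w i j = 0)"
proof -
  define w where "w i j = (if (i, j) \<in> triangle N then lim (\<lambda>k. iterate a b k i j) else 0)" for i j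
  have conv: "(\<lambda>k. iterate a b k i j) \<longlonglongrightarrow> w i j" if ij: "1 \<le> i" "i \<le> j" "j \<le> N" for i j
  proof -
    have "convergent (\<lambda>k. iterate a b k i j)"
    proof (rule Bseq_mono_convergent)
      show "Bseq (\<lambda>k. iterate a b k i j)"
      proof (rule BseqI')
        fix k
        have "iterate a b 0 i j \<le> iterate a b k i j"
          by (rule lift_Suc_mono_le[of "\<lambda>k. iterate a b k i j"])
            (use iterate_Suc_mono[OF ad ij] in auto)
        then show "norm (iterate a b k i j) \<le> barrier N i j"
          using iterate_le_barrier[OF ad ij, of k] by simp
      qed
      show "\<forall>m n. m \<le> n \<longrightarrow> iterate a b m i j \<le> iterate a b n i j"
        using lift_Suc_mono_le[of "\<lambda>k. iterate a b k i j"] iterate_Suc_mono[OF ad ij] by blast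
    qed
    then show ?thesis using ij by (simp add: w_def convergent_LIMSEQ_iff)
  qed
  have "sojourn N a b w"
    unfolding sojourn_def
  proof clarify
    fix i j assume "(i, j) \<in> triangle N"
    then have ij: "1 \<le> i" "i \<le> j" "j \<le> N" by auto
    have A: "(\<lambda>k. a (j + 1) * iterate a b k i (j + 1)) \<longlonglongrightarrow> a (j + 1) * w i (j + 1)"
    proof (cases "j = N")
      case True
      then show ?thesis using ad by (simp add: admissible_def)
    next
      case False
      then show ?thesis using ij by (intro tendsto_intros conv) auto
    qed
    have S: "(\<lambda>k. service b (iterate a b k) i j) \<longlonglongrightarrow> service b w i j"
    proof (cases "i = 1")
      case True
      then show ?thesis using ij by (auto simp: service_def intro!: tendsto_intros conv)
    next
      case False
      have "1 \<le> i - 1" "i - 1 \<le> j - 1" "j - 1 \<le> N" "i - 1 \<le> j" using ij False by auto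
      then show ?thesis
        using False ij(3) unfolding service_def
        by (simp only: if_False) (intro tendsto_intros conv; simp)
    qed
    have "(\<lambda>k. (1 + step a b (iterate a b k) i j) / (lam + mu)) \<longlonglongrightarrow> (1 + step a b w i j) / (lam + mu)"
      unfolding step_def arrival_def
      using lam_pos mu_pos by (intro tendsto_intros A S conv ij) auto
    then have "(\<lambda>k. iterate a b (Suc k) i j) \<longlonglongrightarrow> (1 + step a b w i j) / (lam + mu)"
      by simp
    then have "w i j = (1 + step a b w i j) / (lam + mu)"
      by (rule LIMSEQ_unique[OF LIMSEQ_Suc[OF conv[OF ij]]])
    then show "(lam + mu) * w i j = 1 + step a b w i j"
      using lam_pos mu_pos by (simp add: field_simps)
  qed
  moreover have "\<forall>(i, j) \<in> triangle N. (\<lambda>k. iterate a b k i j) \<longlonglongrightarrow> w i j"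
    using conv by auto
  moreover have "\<forall>i j. (i, j) \<notin> triangle N \<longrightarrow> w i j = 0"
    by (simp add: w_def)
  ultimately show ?thesis by blast
qed

section \<open>Monotonicity in the number of customers and in the position\<close>

text \<open>
  The third clause is monotonicity in the position, seen just after a service with \<open>j + 1\<close> customers
  present: the left side is the remaining time of the customer who was in service, the right
  side that of the one behind her. It has to be carried along, since monotonicity of \<open>w\<close> alone
  does not give it: \<open>w (j + 1) (j + 1)\<close> must not be too large.
\<close>

definition congestion_mono :: "nat \<Rightarrow> (nat \<Rightarrow> nat \<Rightarrow> real) \<Rightarrow> bool" where
  "congestion_mono N w \<longleftrightarrow>
     (\<forall>i j. 1 \<le> i \<longrightarrow> i \<le> j \<longrightarrow> Suc j \<le> N \<longrightarrow> w i j \<le> w i (Suc j))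
   \<and> (\<forall>i j. 1 \<le> i \<longrightarrow> i < j \<longrightarrow> j \<le> N \<longrightarrow> w i j \<le> w (Suc i) j)
   \<and> (\<forall>j. 1 \<le> j \<longrightarrow> Suc j \<le> N \<longrightarrow>
        (1 - q) * w (Suc j) (Suc j) \<le> q * w 1 j + (1 - q) * w 1 (Suc j))"

lemma service_one: "service b w (Suc 0) j = (1 - q) * w j j"
  by (simp add: service_def)

lemma service_Suc:
  assumes "1 \<le> i"
  shows "service (\<lambda>_. 1) w (Suc i) (Suc j) = q * w i j + (1 - q) * w i (Suc j)"
  using assms by (simp add: service_def)

context
  fixes N :: nat and a :: "nat \<Rightarrow> real" and w :: "nat \<Rightarrow> nat \<Rightarrow> real"
  assumes ad: "admissible N a (\<lambda>_. 1)" and anti: "antimono a" and mono: "congestion_mono N w"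
begin

lemma join_prob_range: "0 \<le> a k" "a k \<le> 1"
  using ad by (auto simp: admissible_def)

lemma join_prob_full: "a (Suc N) = 0"
  using ad by (simp add: admissible_def)

lemma mono_customers: "1 \<le> i \<Longrightarrow> i \<le> j \<Longrightarrow> Suc j \<le> N \<Longrightarrow> w i j \<le> w i (Suc j)"
  and mono_position: "1 \<le> i \<Longrightarrow> i < j \<Longrightarrow> j \<le> N \<Longrightarrow> w i j \<le> w (Suc i) j"
  and mono_retry: "1 \<le> j \<Longrightarrow> Suc j \<le> N \<Longrightarrow>
      (1 - q) * w (Suc j) (Suc j) \<le> q * w 1 j + (1 - q) * w 1 (Suc j)"
  using mono by (auto simp: congestion_mono_def)

lemma mono_last: "1 \<le> j \<Longrightarrow> Suc j \<le> N \<Longrightarrow> w j j \<le> w (Suc j) (Suc j)"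
  using mono_customers[of j j] mono_position[of j "Suc j"] by simp

text \<open>
  An arrival never reverses the order: the smaller system grows at most to the size \<open>j + 1\<close> that
  the larger one already has.
\<close>

lemma arrival_mono_customers:
  assumes "1 \<le> i" "i \<le> j" "Suc j \<le> N"
  shows "arrival a w i j \<le> arrival a w i (Suc j)"
proof -
  have "arrival a w i j \<le> a (j + 1) * w i (Suc j) + (1 - a (j + 1)) * w i (Suc j)"
    unfolding arrival_def using assms mono_customers[of i j] join_prob_range[of "j + 1"]
    by (intro add_mono mult_left_mono) auto
  also have "\<dots> = w i (Suc j)" by (simp add: algebra_simps)
  also have "\<dots> \<le> arrival a w i (Suc j)"
  proof (cases "Suc j = N")
    case True
    then show ?thesis using join_prob_full by (simp add: arrival_def)
  next
    case False
    have "a (Suc (Suc j)) * w i (Suc j) \<le> a (Suc (Suc j)) * w i (Suc (Suc j))"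
      using False assms join_prob_range by (intro mult_left_mono mono_customers) auto
    then show ?thesis by (simp add: arrival_def algebra_simps)
  qed
  finally show ?thesis .
qed

lemma arrival_mono_position:
  assumes "1 \<le> i" "i < j" "j \<le> N"
  shows "arrival a w i j \<le> arrival a w (Suc i) j"
proof (cases "j = N")
  case True
  then show ?thesis using join_prob_full mono_position[of i N] assms by (simp add: arrival_def)
next
  case False
  then show ?thesis
    unfolding arrival_def using assms join_prob_range[of "j + 1"]
    by (intro add_mono mult_left_mono mono_position) auto
qed

text \<open>
  With \<open>r\<close> the joining probability at \<open>j + 1\<close> customers, the inequality is averaged with weights
  \<open>r\<close> at \<open>j + 1\<close> and \<open>1 - r\<close> at \<open>j\<close>. The system with \<open>j\<close> customers lets arrivals in at least as
  often as that, which can only enlarge the right side; this is where \<open>a\<close> has to be antitone.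
\<close>

lemma arrival_mono_retry:
  assumes "1 \<le> j" "Suc j \<le> N"
  shows "(1 - q) * arrival a w (Suc j) (Suc j) \<le> q * arrival a w 1 j + (1 - q) * arrival a w 1 (Suc j)"
proof -
  let ?r = "a (Suc (Suc j))"
  have r: "0 \<le> ?r" "?r \<le> 1" "?r \<le> a (Suc j)"
    using join_prob_range anti by (auto intro: antimonoD)
  have joined: "?r * ((1 - q) * w (Suc j) (Suc (Suc j)))
      \<le> ?r * (q * w 1 (Suc j) + (1 - q) * w 1 (Suc (Suc j)))"
  proof (cases "Suc j = N")
    case True
    then show ?thesis using join_prob_full by simp
  next
    case False
    have "(1 - q) * w (Suc j) (Suc (Suc j)) \<le> (1 - q) * w (Suc (Suc j)) (Suc (Suc j))"
      using False assms q_less_1 by (intro mult_left_mono mono_position) auto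
    also have "\<dots> \<le> q * w 1 (Suc j) + (1 - q) * w 1 (Suc (Suc j))"
      using False assms by (intro mono_retry) auto
    finally show ?thesis using r by (intro mult_left_mono)
  qed
  have balked: "(1 - ?r) * ((1 - q) * w (Suc j) (Suc j))
      \<le> (1 - ?r) * (q * w 1 j + (1 - q) * w 1 (Suc j))"
    using r by (intro mult_left_mono mono_retry assms) auto
  have "q * ((a (Suc j) - ?r) * (w 1 (Suc j) - w 1 j)) \<ge> 0"
    using r q_pos mono_customers[of 1 j] assms by (intro mult_nonneg_nonneg) auto
  with joined balked show ?thesis
    by (simp add: arrival_def algebra_simps)
qed

lemma step_gap_customers:
  assumes "1 \<le> i" "i \<le> j" "Suc j \<le> N"
  shows "mu * (service (\<lambda>_. 1) w i (Suc j) - service (\<lambda>_. 1) w i j)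
      \<le> step a (\<lambda>_. 1) w i (Suc j) - step a (\<lambda>_. 1) w i j"
  using mult_left_mono[OF arrival_mono_customers[OF assms], of lam] lam_pos
  by (simp add: step_def algebra_simps)

lemma step_gap_position:
  assumes "1 \<le> i" "i < j" "j \<le> N"
  shows "mu * (service (\<lambda>_. 1) w (Suc i) j - service (\<lambda>_. 1) w i j)
      \<le> step a (\<lambda>_. 1) w (Suc i) j - step a (\<lambda>_. 1) w i j"
  using mult_left_mono[OF arrival_mono_position[OF assms], of lam] lam_pos
  by (simp add: step_def algebra_simps)

lemma step_mono_retry:
  assumes "1 \<le> j" "Suc j \<le> N"
  shows "(1 - q) * step a (\<lambda>_. 1) w (Suc j) (Suc j)
      \<le> q * step a (\<lambda>_. 1) w 1 j + (1 - q) * step a (\<lambda>_. 1) w 1 (Suc j)"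
proof -
  have "(1 - q) * ((1 - q) * w j (Suc j)) \<le> (1 - q) * ((1 - q) * w (Suc j) (Suc j))"
    using assms q_less_1 by (intro mult_left_mono mono_position) auto
  then have "(1 - q) * service (\<lambda>_. 1) w (Suc j) (Suc j)
      \<le> q * service (\<lambda>_. 1) w 1 j + (1 - q) * service (\<lambda>_. 1) w 1 (Suc j)"
    using assms by (simp add: service_Suc service_one algebra_simps)
  from mult_left_mono[OF this, of mu] mult_left_mono[OF arrival_mono_retry[OF assms], of lam]
  show ?thesis
    using lam_pos mu_pos by (simp add: step_def algebra_simps)
qed

text \<open>
  A customer in service who fails becomes last; being last among more customers is worse by both
  kinds of monotonicity.
\<close>

lemma service_mono_customers:
  assumes "1 \<le> i" "i \<le> j" "Suc j \<le> N"
  shows "service (\<lambda>_. 1) w i j \<le> service (\<lambda>_. 1) w i (Suc j)"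
proof (cases "i = 1")
  case True
  then show ?thesis
    using mono_last[of j] assms q_less_1 by (simp add: service_one)
next
  case False
  then obtain i' j' where [simp]: "i = Suc i'" "j = Suc j'" and i': "1 \<le> i'"
    using assms by (cases i; cases j) auto
  show ?thesis
    using assms i' q_pos q_less_1 unfolding \<open>i = Suc i'\<close> \<open>j = Suc j'\<close> service_Suc[OF i']
    by (intro add_mono mult_left_mono mono_customers) auto
qed

text \<open>At the front of the queue this is the retry inequality itself.\<close>

lemma service_mono_position:
  assumes "1 \<le> i" "i < j" "j \<le> N"
  shows "service (\<lambda>_. 1) w i j \<le> service (\<lambda>_. 1) w (Suc i) j"
proof (cases "i = 1")
  case True
  obtain j' where [simp]: "j = Suc j'" using assms by (cases j) auto
  show ?thesis
    using mono_retry[of j'] assms True service_Suc[of 1 w j'] by (simp add: service_one)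
next
  case False
  then obtain i' j' where [simp]: "i = Suc i'" "j = Suc j'" and i': "1 \<le> i'"
    using assms by (cases i; cases j) auto
  have "q * w i' j' + (1 - q) * w i' (Suc j') \<le> q * w (Suc i') j' + (1 - q) * w (Suc i') (Suc j')"
    using assms i' q_pos q_less_1 by (intro add_mono mult_left_mono mono_position) auto
  then show ?thesis using i' by (simp add: service_Suc)
qed

lemma congestion_mono_step:
  "congestion_mono N (\<lambda>i j. (1 + step a (\<lambda>_. 1) w i j) / (lam + mu))"
proof -
  let ?b = "\<lambda>_::nat. 1::real"
  have c: "step a ?b w i j \<le> step a ?b w i (Suc j)" if "1 \<le> i" "i \<le> j" "Suc j \<le> N" for i j
    using step_gap_customers[OF that] service_mono_customers[OF that] mu_pos
    by (smt (verit) mult_nonneg_nonneg)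
  have p: "step a ?b w i j \<le> step a ?b w (Suc i) j" if "1 \<le> i" "i < j" "j \<le> N" for i j
    using step_gap_position[OF that] service_mono_position[OF that] mu_pos
    by (smt (verit) mult_nonneg_nonneg)
  have r: "(1 - q) * (1 + step a ?b w (Suc j) (Suc j))
      \<le> q * (1 + step a ?b w 1 j) + (1 - q) * (1 + step a ?b w 1 (Suc j))"
    if "1 \<le> j" "Suc j \<le> N" for j
    using step_mono_retry[OF that] q_pos by (simp add: algebra_simps)
  have pos: "0 \<le> lam + mu" using lam_pos mu_pos by simp
  have "(1 - q) * ((1 + step a ?b w (Suc j) (Suc j)) / (lam + mu))
      \<le> q * ((1 + step a ?b w 1 j) / (lam + mu)) + (1 - q) * ((1 + step a ?b w 1 (Suc j)) / (lam + mu))"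
    if "1 \<le> j" "Suc j \<le> N" for j
    unfolding times_divide_eq_right add_divide_distrib[symmetric]
    by (rule divide_right_mono[OF r[OF that] pos])
  then show ?thesis
    unfolding congestion_mono_def using c p pos
    by (auto intro!: divide_right_mono)
qed

text \<open>
  The constant 1 of the equations enters the left side of the retry inequality with weight
  \<open>1 - q\<close> and the right side with weight 1. This surplus \<open>q\<close> makes it strict, which starts an
  induction from the front of the queue backwards.
\<close>

lemma strict_mono_position:
  assumes sol: "sojourn N a (\<lambda>_. 1) w" and "1 \<le> i" "i < j" "j \<le> N"
  shows "w i j < w (Suc i) j"
  using assms(2-)
proof (induction i arbitrary: j)
  case 0
  then show ?case by simp
next
  case (Suc i)
  let ?b = "\<lambda>_::nat. 1::real"
  obtain j' where j: "j = Suc j'" and j': "1 \<le> j'" using Suc.prems by (cases j) auto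
  have "service ?b w (Suc i) j < service ?b w (Suc (Suc i)) j"
  proof (cases "i = 0")
    case True
    have "(lam + mu) * ((1 - q) * w j j) < (lam + mu) * (q * w 1 j' + (1 - q) * w 1 j)"
      using step_mono_retry[of j'] sojournD[OF sol, of j j] sojournD[OF sol, of 1 j']
        sojournD[OF sol, of 1 j] Suc.prems j j' q_pos
      by (simp add: algebra_simps)
    then have "(1 - q) * w j j < q * w 1 j' + (1 - q) * w 1 j"
      using lam_pos mu_pos by simp
    then show ?thesis
      using True service_Suc[of 1 w j'] by (simp add: service_one j)
  next
    case False
    have "w i j < w (Suc i) j"
      using False Suc.prems by (intro Suc.IH) auto
    moreover have "w i j' \<le> w (Suc i) j'"
      using False Suc.prems j by (intro mono_position) auto
    ultimately have "q * w i j' + (1 - q) * w i j < q * w (Suc i) j' + (1 - q) * w (Suc i) j"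
      using q_pos q_less_1 by (intro add_le_less_mono mult_left_mono mult_strict_left_mono) auto
    then show ?thesis using False by (simp add: service_Suc j)
  qed
  then have "0 < mu * (service ?b w (Suc (Suc i)) j - service ?b w (Suc i) j)"
    using mu_pos by simp
  also note step_gap_position[OF Suc.prems]
  finally have "(lam + mu) * w (Suc i) j < (lam + mu) * w (Suc (Suc i)) j"
    using sojournD[OF sol, of "Suc i" j] sojournD[OF sol, of "Suc (Suc i)" j] Suc.prems by simp
  then show ?case using lam_pos mu_pos by simp
qed

text \<open>
  At the front, a failure leads to the last position, where an additional customer strictly
  increases the position.
\<close>

lemma strict_mono_customers:
  assumes sol: "sojourn N a (\<lambda>_. 1) w" and "1 \<le> i" "i \<le> j" "Suc j \<le> N"
  shows "w i j < w i (Suc j)"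
  using assms(2-)
proof (induction i arbitrary: j)
  case 0
  then show ?case by simp
next
  case (Suc i)
  let ?b = "\<lambda>_::nat. 1::real"
  obtain j' where j: "j = Suc j'" using Suc.prems by (cases j) auto
  have "service ?b w (Suc i) j < service ?b w (Suc i) (Suc j)"
  proof (cases "i = 0")
    case True
    have "w j j \<le> w j (Suc j)" using Suc.prems by (intro mono_customers) auto
    also have "\<dots> < w (Suc j) (Suc j)"
      using Suc.prems by (intro strict_mono_position[OF sol]) auto
    finally show ?thesis using True q_less_1 by (simp add: service_one)
  next
    case False
    have "w i j < w i (Suc j)"
      using False Suc.prems by (intro Suc.IH) auto
    moreover have "w i j' \<le> w i j"
      using False Suc.prems unfolding j by (intro mono_customers) auto
    ultimately have "q * w i j' + (1 - q) * w i j < q * w i j + (1 - q) * w i (Suc j)"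
      using q_pos q_less_1 by (intro add_le_less_mono mult_left_mono mult_strict_left_mono) auto
    then show ?thesis using False by (simp add: service_Suc j)
  qed
  then have "0 < mu * (service ?b w (Suc i) (Suc j) - service ?b w (Suc i) j)"
    using mu_pos by simp
  also note step_gap_customers[OF Suc.prems]
  finally have "(lam + mu) * w (Suc i) j < (lam + mu) * w (Suc i) (Suc j)"
    using sojournD[OF sol, of "Suc i" j] sojournD[OF sol, of "Suc i" "Suc j"] Suc.prems by simp
  then show ?case using lam_pos mu_pos by simp
qed

end

lemma sojourn_congestion_mono:
  assumes ad: "admissible N a (\<lambda>_. 1)" and anti: "antimono a" and sol: "sojourn N a (\<lambda>_. 1) w"
  shows "congestion_mono N w"
proof -
  let ?I = "iterate a (\<lambda>_. 1)"
  have it: "congestion_mono N (?I k)" for k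
  proof (induction k)
    case 0
    show ?case by (simp add: congestion_mono_def)
  next
    case (Suc k)
    show ?case
      using congestion_mono_step[OF ad anti Suc.IH] by (simp add: congestion_mono_def)
  qed
  obtain v where v: "sojourn N a (\<lambda>_. 1) v"
    and lim: "\<forall>(i, j) \<in> triangle N. (\<lambda>k. ?I k i j) \<longlonglongrightarrow> v i j"
    using iterate_converges[OF ad] by blast
  have lim_w: "(\<lambda>k. ?I k i j) \<longlonglongrightarrow> w i j" if "1 \<le> i" "i \<le> j" "j \<le> N" for i j
    using lim sojourn_unique[OF ad v sol that] that by (auto dest!: bspec[of _ _ "(i, j)"])
  have le: "w i j \<le> w i' j'"
    if "\<And>k. ?I k i j \<le> ?I k i' j'" "1 \<le> i" "i \<le> j" "j \<le> N" "1 \<le> i'" "i' \<le> j'" "j' \<le> N"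
    for i j i' j'
    using that by (intro lim_mono[of 0, OF _ lim_w lim_w]) auto
  have "(1 - q) * w (Suc j) (Suc j) \<le> q * w 1 j + (1 - q) * w 1 (Suc j)"
    if j: "1 \<le> j" "Suc j \<le> N" for j
  proof (rule lim_mono[of 0])
    show "(1 - q) * ?I k (Suc j) (Suc j) \<le> q * ?I k 1 j + (1 - q) * ?I k 1 (Suc j)" for k
      using it[of k] j unfolding congestion_mono_def by blast
    show "(\<lambda>k. (1 - q) * ?I k (Suc j) (Suc j)) \<longlonglongrightarrow> (1 - q) * w (Suc j) (Suc j)"
      by (rule tendsto_mult_left[OF lim_w]) (use j in auto)
    show "(\<lambda>k. q * ?I k 1 j + (1 - q) * ?I k 1 (Suc j))
        \<longlonglongrightarrow> q * w 1 j + (1 - q) * w 1 (Suc j)"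
      by (rule tendsto_add[OF tendsto_mult_left[OF lim_w] tendsto_mult_left[OF lim_w]])
        (use j in auto)
  qed
  moreover have "w i j \<le> w i (Suc j)" if "1 \<le> i" "i \<le> j" "Suc j \<le> N" for i j
    using it that unfolding congestion_mono_def by (intro le) auto
  moreover have "w i j \<le> w (Suc i) j" if "1 \<le> i" "i < j" "j \<le> N" for i j
    using it that unfolding congestion_mono_def by (intro le) auto
  ultimately show ?thesis
    unfolding congestion_mono_def by blast
qed

section \<open>Comparison of the two systems\<close>

text \<open>
  The first term stems from additional arrivals, the second from customers who stay instead of
  reneging; both multiply the effect of one more customer in the system.
\<close>

lemma step_defect:
  "step a' (\<lambda>_. 1) w i j - step a b w i j =
     lam * ((a' (j + 1) - a (j + 1)) * (w i (j + 1) - w i j))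
   + (if i = 1 then 0 else mu * ((1 - q) * (1 - b j) * (w (i - 1) j - w (i - 1) (j - 1))))"
  by (simp add: step_def arrival_def service_def algebra_simps)

context
  fixes N :: nat and a b a' :: "nat \<Rightarrow> real" and t w :: "nat \<Rightarrow> nat \<Rightarrow> real"
  assumes ad: "admissible N a b" and ad': "admissible N a' (\<lambda>_. 1)" and anti': "antimono a'"
    and a_le: "\<And>j. a j \<le> a' j"
    and t: "sojourn N a b t" and w: "sojourn N a' (\<lambda>_. 1) w"
begin

lemma step_le_step_full:
  assumes ij: "1 \<le> i" "i \<le> j" "j \<le> N"
  shows "step a b w i j \<le> step a' (\<lambda>_. 1) w i j"
proof -
  note mono = sojourn_congestion_mono[OF ad' anti' w]
  have "0 \<le> (a' (j + 1) - a (j + 1)) * (w i (j + 1) - w i j)"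
  proof (cases "j = N")
    case True
    then show ?thesis using ad ad' by (simp add: admissible_def)
  next
    case False
    then show ?thesis
      using ij mono_customers[OF ad' anti' mono, of i j] a_le[of "j + 1"] by simp
  qed
  moreover have "0 \<le> (1 - q) * (1 - b j) * (w (i - 1) j - w (i - 1) (j - 1))" if "i \<noteq> 1"
    using ij that ad q_less_1 mono_customers[OF ad' anti' mono, of "i - 1" "j - 1"]
    by (intro mult_nonneg_nonneg) (auto simp: admissible_def)
  ultimately show ?thesis
    using step_defect[of a' w i j a b] lam_pos mu_pos
    by (smt (verit) mult_nonneg_nonneg)
qed

lemma sojourn_mono:
  assumes ij: "1 \<le> i" "i \<le> j" "j \<le> N"
  shows "t i j \<le> w i j"
proof -
  have "t i j - w i j \<le> 0"
  proof (rule maximum_principle[OF ad _ ij])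
    fix i j assume ij: "1 \<le> i" "i \<le> j" "j \<le> N"
    show "(lam + mu) * (t i j - w i j) \<le> step a b (\<lambda>i j. t i j - w i j) i j"
      using step_le_step_full[OF ij] sojournD[OF t ij] sojournD[OF w ij]
      by (simp add: step_diff right_diff_distrib)
  qed
  then show ?thesis by simp
qed

text \<open>
  With \<open>N\<close> customers present, one who fails in front of the tagged customer may renege, and by
  strict monotonicity her departure helps.
\<close>

lemma sojourn_last_less:
  assumes N: "2 \<le> N" and b: "b N < 1"
  shows "t N N < w N N"
proof -
  have "w (N - 1) (N - 1) < w (N - 1) (Suc (N - 1))"
    using N by (intro strict_mono_customers[OF ad' anti' _ w] sojourn_congestion_mono[OF ad' anti' w]) auto
  then have "0 < mu * ((1 - q) * (1 - b N) * (w (N - 1) N - w (N - 1) (N - 1)))"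
    using N b q_less_1 mu_pos by simp
  moreover have "a (N + 1) = 0" "a' (N + 1) = 0"
    using ad ad' by (auto simp: admissible_def)
  ultimately have "step a b w N N < step a' (\<lambda>_. 1) w N N"
    using step_defect[of a' w N N a b] N by simp
  moreover have "step a b t N N \<le> step a b w N N"
    using N by (intro step_mono[OF ad] sojourn_mono) auto
  ultimately have "(lam + mu) * t N N < (lam + mu) * w N N"
    using sojournD[OF t, of N N] sojournD[OF w, of N N] N by simp
  then show ?thesis using lam_pos mu_pos by simp
qed

end

section \<open>Threshold strategies\<close>

lemma threshold_strategy_range:
  assumes "0 \<le> x"
  shows "0 \<le> threshold_strategy x i" "threshold_strategy x i \<le> 1"
  using assms by (auto simp: threshold_strategy_def Let_def) linarith+

lemma threshold_strategy_mono:
  assumes "0 \<le> x" "x \<le> y"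
  shows "threshold_strategy x i \<le> threshold_strategy y i"
proof -
  consider "nat \<lfloor>x\<rfloor> = nat \<lfloor>y\<rfloor>" | "nat \<lfloor>x\<rfloor> < nat \<lfloor>y\<rfloor>"
    using assms by linarith
  then show ?thesis
  proof cases
    case 1
    then show ?thesis using assms by (simp add: threshold_strategy_def Let_def)
  next
    case 2
    show ?thesis
    proof (cases "i \<le> nat \<lfloor>y\<rfloor>")
      case True
      then have "threshold_strategy y i = 1" by (simp add: threshold_strategy_def Let_def)
      then show ?thesis using threshold_strategy_range[of x i] assms by simp
    next
      case False
      then have "nat \<lfloor>x\<rfloor> + 1 < i" using 2 by linarith
      then have "threshold_strategy x i = 0" by (simp add: threshold_strategy_def Let_def)
      then show ?thesis using threshold_strategy_range[of y i] assms by simp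
    qed
  qed
qed

lemma antimono_threshold_strategy:
  assumes "0 \<le> x"
  shows "antimono (threshold_strategy x)"
proof (rule antimonoI)
  fix i j :: nat assume "i \<le> j"
  then show "threshold_strategy x j \<le> threshold_strategy x i"
    using threshold_strategy_range[OF assms, of i] threshold_strategy_range[OF assms, of j]
    by (auto simp: threshold_strategy_def Let_def split: if_splits)
qed

lemma threshold_strategy_beyond:
  assumes "0 \<le> x" "x \<le> real N"
  shows "threshold_strategy x (N + 1) = 0"
proof (cases "x = real N")
  case False
  then have "nat \<lfloor>x\<rfloor> < N" using assms by linarith
  then show ?thesis by (simp add: threshold_strategy_def Let_def)
qed (simp add: threshold_strategy_def Let_def)

lemma admissible_threshold:
  assumes "0 \<le> x" "x \<le> real N"
  shows "admissible N (threshold_strategy x) (\<lambda>_. 1)"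
    and "admissible N (threshold_strategy x) (threshold_strategy x)"
  using threshold_strategy_beyond[OF assms] threshold_strategy_range[OF assms(1)]
  by (auto simp: admissible_def)

lemma N_equations_iff:
  "N_equations lam mu q x w \<longleftrightarrow> sojourn (nat \<lceil>x\<rceil> + 1) (threshold_strategy x) (\<lambda>_. 1) w"
  by (auto simp: N_equations_def sojourn_def step_def arrival_def service_def N_service_term_def)

text \<open>
  The equations may be restricted to a smaller triangle, because systems with thresholds from the
  same interval \<open>n \<le> x \<le> n + 1\<close>, whose triangles differ, are compared on \<open>triangle (n + 1)\<close>.
\<close>

lemma N_time_sojourn:
  assumes "0 \<le> x" "N \<le> nat \<lceil>x\<rceil> + 1"
  shows "sojourn N (threshold_strategy x) (\<lambda>_. 1) (N_time lam mu q x)"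
proof -
  let ?N = "nat \<lceil>x\<rceil> + 1" and ?u = "threshold_strategy x"
  have ad: "admissible ?N ?u (\<lambda>_. 1)"
    using assms(1) by (intro admissible_threshold) linarith+
  have "\<exists>!w. N_equations lam mu q x w \<and> (\<forall>i j. (i, j) \<notin> triangle ?N \<longrightarrow> w i j = 0)"
  proof (rule ex_ex1I)
    show "\<exists>w. N_equations lam mu q x w \<and> (\<forall>i j. (i, j) \<notin> triangle ?N \<longrightarrow> w i j = 0)"
      unfolding N_equations_iff using iterate_converges[OF ad] by blast
  next
    fix v w
    assume v: "N_equations lam mu q x v \<and> (\<forall>i j. (i, j) \<notin> triangle ?N \<longrightarrow> v i j = 0)"
      and w: "N_equations lam mu q x w \<and> (\<forall>i j. (i, j) \<notin> triangle ?N \<longrightarrow> w i j = 0)"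
    show "v = w"
    proof (intro ext)
      fix i j
      show "v i j = w i j"
      proof (cases "(i, j) \<in> triangle ?N")
        case True
        then show ?thesis
          using v w by (intro sojourn_unique[OF ad]) (auto simp: N_equations_iff)
      next
        case False
        with v w show ?thesis by metis
      qed
    qed
  qed
  from theI'[OF this] have "sojourn ?N ?u (\<lambda>_. 1) (N_time lam mu q x)"
    by (simp add: N_time_def N_equations_iff)
  then show ?thesis using assms(2) by (auto simp: sojourn_def)
qed

text \<open>
  A tagged customer with threshold \<open>n + 1\<close> stays in every position of \<open>triangle (n + 1)\<close>, so she
  is rewarded with certainty, and \<open>R0\<close> minus her payoff is a time.
\<close>

lemma R_equations_iff:
  assumes "nat \<lfloor>x\<rfloor> = n"
  shows "R_equations lam mu q R0 (real (n + 1)) x z \<longleftrightarrow>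
    sojourn (n + 1) (threshold_strategy x) (threshold_strategy x) (\<lambda>i j. R0 - z i j)"
proof -
  let ?u = "threshold_strategy x"
  have eq: "((lam + mu) * z i j =
        - 1 + lam * (?u (j + 1) * z i (j + 1) + (1 - ?u (j + 1)) * z i j)
            + mu * R_service_term q R0 (real (n + 1)) x z i j)
     \<longleftrightarrow> (lam + mu) * (R0 - z i j) = 1 + step ?u ?u (\<lambda>i j. R0 - z i j) i j"
    if "j \<le> n + 1" for i j
  proof -
    have "threshold_strategy (real (n + 1)) j = 1"
      using that by (simp add: threshold_strategy_def Let_def nat_add_distrib)
    then have S: "service ?u (\<lambda>i j. R0 - z i j) i j = R0 - R_service_term q R0 (real (n + 1)) x z i j"
      by (simp add: service_def R_service_term_def algebra_simps)
    have A: "arrival ?u (\<lambda>i j. R0 - z i j) i j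
        = R0 - (?u (j + 1) * z i (j + 1) + (1 - ?u (j + 1)) * z i j)"
      by (simp add: arrival_def algebra_simps)
    show ?thesis
      unfolding step_def S A by (auto simp: algebra_simps)
  qed
  show ?thesis
    unfolding R_equations_def sojourn_def assms using eq by (auto simp del: of_nat_Suc of_nat_add)
qed

lemma R_payoff_sojourn:
  assumes "0 \<le> x" and n: "nat \<lfloor>x\<rfloor> = n"
  shows "sojourn (n + 1) (threshold_strategy x) (threshold_strategy x)
           (\<lambda>i j. R0 - R_payoff lam mu q R0 (real (n + 1)) x i j)"
proof -
  let ?N = "n + 1" and ?u = "threshold_strategy x" and ?y = "real (n + 1)"
  have ad: "admissible ?N ?u ?u"
    using assms by (intro admissible_threshold) linarith+
  have "\<exists>!z. R_equations lam mu q R0 ?y x z \<and> (\<forall>i j. (i, j) \<notin> triangle ?N \<longrightarrow> z i j = 0)"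
  proof (rule ex_ex1I)
    obtain t where t: "sojourn ?N ?u ?u t" using iterate_converges[OF ad] by blast
    define z where "z i j = (if (i, j) \<in> triangle ?N then R0 - t i j else 0)" for i j
    have "sojourn ?N ?u ?u (\<lambda>i j. R0 - z i j)"
      unfolding sojourn_def
    proof clarify
      fix i j assume "(i, j) \<in> triangle ?N"
      then have ij: "1 \<le> i" "i \<le> j" "j \<le> ?N" by auto
      have "step ?u ?u (\<lambda>i j. R0 - z i j) i j = step ?u ?u t i j"
        by (rule step_cong[OF ad _ ij]) (simp add: z_def)
      then show "(lam + mu) * (R0 - z i j) = 1 + step ?u ?u (\<lambda>i j. R0 - z i j) i j"
        using ij sojournD[OF t ij] by (simp add: z_def)
    qed
    moreover have "\<forall>i j. (i, j) \<notin> triangle ?N \<longrightarrow> z i j = 0"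
      by (simp add: z_def)
    ultimately show "\<exists>z. R_equations lam mu q R0 ?y x z \<and> (\<forall>i j. (i, j) \<notin> triangle ?N \<longrightarrow> z i j = 0)"
      unfolding R_equations_iff[OF n] by blast
  next
    fix v z
    assume v: "R_equations lam mu q R0 ?y x v \<and> (\<forall>i j. (i, j) \<notin> triangle ?N \<longrightarrow> v i j = 0)"
      and z: "R_equations lam mu q R0 ?y x z \<and> (\<forall>i j. (i, j) \<notin> triangle ?N \<longrightarrow> z i j = 0)"
    show "v = z"
    proof (intro ext)
      fix i j
      show "v i j = z i j"
      proof (cases "(i, j) \<in> triangle ?N")
        case True
        then have "R0 - v i j = R0 - z i j"
          using v z unfolding R_equations_iff[OF n]
          by (intro sojourn_unique[OF ad, of "\<lambda>i j. R0 - v i j" "\<lambda>i j. R0 - z i j"]) auto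
        then show ?thesis by simp
      next
        case False
        with v z show ?thesis by metis
      qed
    qed
  qed
  from theI'[OF this] have "R_equations lam mu q R0 ?y x (R_payoff lam mu q R0 ?y x)"
    unfolding R_payoff_def n by (rule conjunct1)
  then show ?thesis by (simp only: R_equations_iff[OF n])
qed

section \<open>Comparison of the equilibria\<close>

lemma N_alpha_le_N_beta:
  assumes "1 \<le> m"
  shows "N_alpha lam mu q m \<le> N_beta lam mu q m"
proof -
  let ?u = "threshold_strategy (real m)"
  have ad: "admissible (m + 1) ?u (\<lambda>_. 1)" by (intro admissible_threshold) auto
  have anti: "antimono ?u" by (rule antimono_threshold_strategy) simp
  have sol: "sojourn (m + 1) ?u (\<lambda>_. 1) (N_time lam mu q (real m))"
    by (rule N_time_sojourn) auto
  show ?thesis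
    using mono_last[OF ad anti sojourn_congestion_mono[OF ad anti sol], of m] assms
    by (simp add: N_alpha_def N_beta_def)
qed

text \<open>
  Interleaving with \<open>N_beta\<close>: one more customer under the same threshold, then a larger threshold
  for the same state.
\<close>

lemma N_alpha_mono:
  assumes "1 \<le> m" "m \<le> k"
  shows "N_alpha lam mu q m \<le> N_alpha lam mu q k"
  using assms(2)
proof (induction k rule: dec_induct)
  case base
  show ?case by simp
next
  case (step k)
  have "N_alpha lam mu q k \<le> N_beta lam mu q k"
    using step assms by (intro N_alpha_le_N_beta) auto
  also have "\<dots> \<le> N_alpha lam mu q (Suc k)"
  proof -
    let ?u = "\<lambda>k. threshold_strategy (real k)"
    have ad: "admissible (k + 1) (?u l) (\<lambda>_. 1)" if "l \<le> k + 1" for l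
      using that by (intro admissible_threshold) auto
    have sol: "sojourn (k + 1) (?u l) (\<lambda>_. 1) (N_time lam mu q (real l))" if "k \<le> l" for l
      using that by (intro N_time_sojourn) auto
    have anti: "antimono (?u (Suc k))" by (intro antimono_threshold_strategy) simp
    have "?u k j \<le> ?u (Suc k) j" for j by (intro threshold_strategy_mono) auto
    then have "N_time lam mu q (real k) (k + 1) (k + 1)
        \<le> N_time lam mu q (real (Suc k)) (k + 1) (k + 1)"
      using sojourn_mono[OF ad[of k] ad[of "Suc k"] anti _ sol[of k] sol[of "Suc k"]] by simp
    then show ?thesis by (simp add: N_alpha_def N_beta_def)
  qed
  finally show ?case using step.IH by simp
qed

lemma R_time_less_N_time:
  assumes n: "1 \<le> n" "real n \<le> x" "x < real (n + 1)" and x': "x < x'" "x' \<le> real (n + 1)"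
  shows "R0 - R_payoff lam mu q R0 (real (n + 1)) x (n + 1) (n + 1)
       < N_time lam mu q x' (n + 1) (n + 1)"
proof -
  have fl: "nat \<lfloor>x\<rfloor> = n" using n by linarith
  have nn: "0 \<le> x" "0 \<le> x'" using n x' by auto
  have "n + 1 \<le> nat \<lceil>x'\<rceil> + 1" using n x' by linarith
  then have w: "sojourn (n + 1) (threshold_strategy x') (\<lambda>_. 1) (N_time lam mu q x')"
    using nn by (intro N_time_sojourn) auto
  show ?thesis
  proof (rule sojourn_last_less[OF _ _ _ _ R_payoff_sojourn[OF nn(1) fl] w])
    show "admissible (n + 1) (threshold_strategy x) (threshold_strategy x)"
      "admissible (n + 1) (threshold_strategy x') (\<lambda>_. 1)"
      using nn n x' by (auto intro!: admissible_threshold)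
    show "antimono (threshold_strategy x')" by (rule antimono_threshold_strategy[OF nn(2)])
    show "threshold_strategy x j \<le> threshold_strategy x' j" for j
      using nn x' by (intro threshold_strategy_mono) auto
    show "2 \<le> n + 1" using n by simp
    show "threshold_strategy x (n + 1) < 1"
      using fl n by (simp add: threshold_strategy_def Let_def)
  qed
qed

text \<open>
  Both kinds of equilibria are first brought to a common form, an integer part together with the
  inequality that the integral and the fractional case share.
\<close>

lemma R_equilibrium_ge_N_equilibrium:
  assumes N: "N_equilibrium lam mu q R0 x" and R: "R_equilibrium lam mu q R0 y"
  shows "x \<le> y"
proof -
  have N_cases: "(R0 < N_alpha lam mu q 1 \<and> x = 0) \<or>
      (\<exists>m\<ge>1. N_alpha lam mu q m \<le> R0 \<and>
         (x = real m \<or> real m < x \<and> x < real (m + 1) \<and> N_time lam mu q x (m + 1) (m + 1) = R0))"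
    using N unfolding N_equilibrium_def
  proof (elim disjE exE conjE, goal_cases)
    case (3 m)
    then show ?case using N_alpha_le_N_beta[of m] by (intro disjI2 exI[of _ m]) simp
  qed auto
  have R_cases: "(R0 < N_alpha lam mu q 1 \<and> y = 0) \<or>
      (\<exists>n\<ge>1. real n \<le> y \<and> y < real (n + 1) \<and>
         R_payoff lam mu q R0 (real (n + 1)) y (n + 1) (n + 1) \<le> 0)"
    using R unfolding R_equilibrium_def
  proof (elim disjE exE conjE, goal_cases)
    case (2 m)
    then show ?case by (intro disjI2 exI[of _ m]) simp
  next
    case (3 m)
    then show ?case by (intro disjI2 exI[of _ m]) simp
  qed auto
  show ?thesis
  proof (cases "N_alpha lam mu q 1 \<le> R0")
    case False
    have "N_alpha lam mu q 1 \<le> N_alpha lam mu q m" if "1 \<le> m" for m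
      using N_alpha_mono[of 1 m] that by simp
    with False N_cases have "x = 0" by force
    with R_cases show ?thesis by force
  next
    case True
    then obtain m where "1 \<le> m" and alpha: "N_alpha lam mu q m \<le> R0"
      and x: "x = real m \<or>
        real m < x \<and> x < real (m + 1) \<and> N_time lam mu q x (m + 1) (m + 1) = R0"
      using N_cases by auto
    from True obtain n where n: "1 \<le> n" "real n \<le> y" "y < real (n + 1)"
      and pay: "R_payoff lam mu q R0 (real (n + 1)) y (n + 1) (n + 1) \<le> 0"
      using R_cases by auto
    note less = R_time_less_N_time[OF n, of _ R0]
    \<comment> \<open>\<open>N_alpha\<close> at \<open>n + 1\<close> is the time when the others use the threshold \<open>n + 1\<close>.\<close>
    have "R0 < N_alpha lam mu q (n + 1)"
      using less[of "real (n + 1)"] n(3) pay by (simp add: N_alpha_def)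
    then have "m \<le> n"
      using N_alpha_mono[of "n + 1" m] alpha by (cases "m \<le> n") auto
    then consider "m = n" | "real (m + 1) \<le> real n" by linarith
    then show ?thesis
    proof cases
      case 1
      show ?thesis
      proof (rule ccontr)
        assume "\<not> x \<le> y"
        with x 1 n(2) have "y < x" "x \<le> real (n + 1)" "N_time lam mu q x (n + 1) (n + 1) = R0"
          by auto
        then show False using less[of x] pay by simp
      qed
    next
      case 2
      then show ?thesis using x n(2) by auto
    qed
  qed
qed

end

theorem theorem4p1:
  fixes lam mu q R0 x_e xhat_e :: real
  assumes "lam > 0" and "mu > 0" and "0 < q" and "q < 1" and "R0 > 0"
    and "N_equilibrium lam mu q R0 x_e"
    and "R_equilibrium lam mu q R0 xhat_e"
  shows "xhat_e \<ge> x_e"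
proof -
  interpret feedback_queue lam mu q
    using assms by unfold_locales
  show ?thesis
    using assms R_equilibrium_ge_N_equilibrium by blast
qed

end
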